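(* Let $n$ be a nonnegative integer or $\infty$, and let $p:\mathbb{R}\to\mathbb{R}$ be a function with $p\notin C^n(\mathbb{R},\mathbb{R})$. Define $$\mathcal{A}_p=\{f\in C^n(\mathbb{R},\mathbb{R}) \mid \text{the function } x\mapsto f(p(x)+c) \text{ belongs to } C^n(\mathbb{R},\mathbb{R}) \text{ for every } c\in\mathbb{R}\}.$$ Then either $\mathcal{A}_p$ is exactly the set of constant functions $\mathbb{R}\to\mathbb{R}$, or there exists a nonzero constant $d\in\mathbb{R}$ such that $\mathcal{A}_p=C^n_d(\mathbb{R},\mathbb{R})$.
   Context: $C^n(\mathbb{R},\mathbb{R})$ is the set of $n$ times continuously differentiable functions $\mathbb{R}\to\mathbb{R}$ (continuous functions if $n=0$, smooth functions if $n=\infty$). For $d\neq 0$, $C^n_d(\mathbb{R},\mathbb{R})$ is the set of all $f\in C^n(\mathbb{R},\mathbb{R})$ with period $d$, i.e. $f(y+d)=f(y)$ for all $y\in\mathbb{R}$ ($d$ need not be a minimal period). *)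

theory Defs
  imports "HOL-Analysis.Analysis" "HOL-Library.Extended_Nat"
begin

(* deriv is a total function, so the existence of each derivative taken has to be
   required separately.  The index \<infinity> gives the smooth functions. *)
definition Cn :: "enat \<Rightarrow> (real \<Rightarrow> real) set" where
  "Cn n = {f. (\<forall>k. enat k < n \<longrightarrow> (deriv ^^ k) f differentiable_on UNIV) \<and>
              (\<forall>k. enat k \<le> n \<longrightarrow> continuous_on UNIV ((deriv ^^ k) f))}"

lemma Cn_0: "Cn 0 = {f. continuous_on UNIV f}"
  by (auto simp: Cn_def zero_enat_def)

lemma Cn_infinity: "Cn \<infinity> = (\<Inter>n. Cn (enat n))"
  by (auto simp: Cn_def)

lemma Cn_Suc:
  "Cn (enat (Suc n)) = {f. f differentiable_on UNIV \<and> deriv f \<in> Cn (enat n)}"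
proof -
  have shift: "(deriv ^^ k) (deriv f) = (deriv ^^ Suc k) f" for k and f :: "real \<Rightarrow> real"
    by (simp add: funpow_Suc_right del: funpow.simps)
  have all: "(\<forall>k. P k) \<longleftrightarrow> P 0 \<and> (\<forall>k. P (Suc k))" for P :: "nat \<Rightarrow> bool"
    by (metis nat.exhaust)
  show ?thesis
    unfolding Cn_def mem_Collect_eq shift
    by (subst all, subst (2) all) (auto intro: differentiable_imp_continuous_on)
qed

(* d need not be a minimal period; the notion is only used for d \<noteq> 0. *)
definition Cn_periodic :: "enat \<Rightarrow> real \<Rightarrow> (real \<Rightarrow> real) set" where
  "Cn_periodic n d = {f \<in> Cn n. \<forall>y. f (y + d) = f y}"

definition A_set :: "enat \<Rightarrow> (real \<Rightarrow> real) \<Rightarrow> (real \<Rightarrow> real) set" where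
  "A_set n p = {f \<in> Cn n. \<forall>c. (\<lambda>x. f (p x + c)) \<in> Cn n}"

end

theory Submission
  imports Defs "HOL-Library.Periodic_Fun"
begin

text \<open>Let \<open>P\<close> be the closed group of common periods of the functions in \<open>A_set n p\<close>. If
  \<open>P = UNIV\<close>, these functions are constant. Otherwise \<open>P\<close> consists of the multiples of some \<open>d\<close>,
  and any finite limit of values \<open>p (x k)\<close>, \<open>x k \<longlonglongrightarrow> x0\<close>, differs from \<open>p x0\<close> by an element of
  \<open>P\<close>. Hence \<open>p\<close> agrees locally, modulo \<open>P\<close>, with a continuous function \<open>q\<close>: for \<open>d \<noteq> 0\<close> because
  the circle is compact, for \<open>d = 0\<close> by Baire's theorem. If \<open>f\<close> is a nonconstant function
  in \<open>A_set n p\<close>, a suitable translate of \<open>f\<close> is invertible near \<open>q x0\<close>, so \<open>q\<close> is as smooth as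
  \<open>f (p x + c)\<close>. For \<open>d = 0\<close> this gives \<open>p \<in> Cn n\<close>; for \<open>d \<noteq> 0\<close> it shows that every function in
  \<open>Cn_periodic n d\<close> belongs to \<open>A_set n p\<close>.\<close>

section \<open>Closed subgroups of the reals\<close>

text \<open>If the positive elements have infimum 0, multiples of small ones are dense, and
  closedness gives all of the reals. Otherwise the infimum is attained and generates
  \<open>G\<close> by division with remainder. The value \<open>d = 0\<close> covers the trivial
  group.\<close>

lemma closed_subgroup_real_cases:
  fixes G :: "real set"
  assumes zero: "0 \<in> G" and diff: "\<And>x y. x \<in> G \<Longrightarrow> y \<in> G \<Longrightarrow> x - y \<in> G"
    and "closed G"
  obtains "G = UNIV" | d where "d \<ge> 0" "G = range (\<lambda>k. of_int k * d)"
proof -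
  have minus: "- x \<in> G" if "x \<in> G" for x
    using diff[OF zero that] by simp
  have add: "x + y \<in> G" if "x \<in> G" "y \<in> G" for x y
    using diff[OF that(1) minus[OF that(2)]] by simp
  have nat_mult: "of_nat m * x \<in> G" if "x \<in> G" for m x
    by (induction m) (use zero add that in \<open>auto simp: algebra_simps\<close>)
  have int_mult: "of_int k * x \<in> G" if "x \<in> G" for k x
    using nat_mult[OF that, of "nat k"] minus[OF nat_mult[OF that, of "nat (- k)"]]
    by (cases "k \<ge> 0") auto
  define D where "D = G \<inter> {0<..}"
  define d where "d = Inf D"
  have lower: "d \<le> x" if "x \<in> D" for x
    unfolding d_def by (rule cInf_lower[OF that]) (auto simp: D_def intro!: bdd_belowI[of _ 0])
  \<comment> \<open>Remainder modulo \<open>g\<close>: for small \<open>g\<close> it bounds the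
    distance of \<open>x\<close> to a multiple of \<open>g\<close>; for \<open>g = d\<close> and
    \<open>x\<close> in \<open>G\<close> it must vanish, as no element of \<open>D\<close> lies
    below \<open>d\<close>.\<close>
  have floor_bounds: "0 \<le> x - of_int \<lfloor>x / g\<rfloor> * g \<and> x - of_int \<lfloor>x / g\<rfloor> * g < g"
    if "g > 0" for x g :: real
    using that floor_divide_lower[OF that, of x] floor_divide_upper[OF that, of x]
    by (simp add: algebra_simps)
  show thesis
  proof (cases "D = {}")
    case True
    have "x = 0" if "x \<in> G" for x
      using True that minus[OF that] unfolding D_def by (cases "x > 0"; cases "x < 0") auto
    then have "G = range (\<lambda>k. of_int k * 0)"
      using zero by auto
    then show thesis
      using that(2)[of 0] by simp
  next
    case False
    have "d \<ge> 0"
      unfolding d_def using False by (intro cInf_greatest) (auto simp: D_def)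
    have near: "\<exists>g\<in>D. g < d + e" if "e > 0" for e
      using cInf_lessD[OF False, of "d + e"] that unfolding d_def by auto
    show thesis
    proof (cases "d = 0")
      case True
      have "x \<in> closure G" for x
        unfolding closure_approachable
      proof (intro allI impI)
        fix e :: real
        assume "e > 0"
        then obtain g where g: "g \<in> D" "g < e"
          using near True by force
        then have "dist (of_int \<lfloor>x / g\<rfloor> * g) x < e"
          using floor_bounds[of g x] by (auto simp: D_def dist_real_def)
        then show "\<exists>y\<in>G. dist y x < e"
          using int_mult g(1) unfolding D_def by blast
      qed
      then have "G = UNIV"
        using \<open>closed G\<close> by auto
      then show thesis
        by (rule that(1))
    next
      case False
      with \<open>d \<ge> 0\<close> have "d > 0"
        by simp
      have "d \<in> closure G"
        unfolding closure_approachable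
      proof (intro allI impI)
        fix e :: real
        assume "e > 0"
        then obtain g where "g \<in> D" "g < d + e"
          using near by blast
        then show "\<exists>y\<in>G. dist y d < e"
          using lower[of g] by (intro bexI[of _ g]) (auto simp: dist_real_def D_def)
      qed
      then have "d \<in> G"
        using \<open>closed G\<close> by simp
      have "x \<in> range (\<lambda>k. of_int k * d)" if "x \<in> G" for x
      proof -
        have "x - of_int \<lfloor>x / d\<rfloor> * d \<in> G"
          using diff that int_mult \<open>d \<in> G\<close> by blast
        then have "x = of_int \<lfloor>x / d\<rfloor> * d"
          using floor_bounds[OF \<open>d > 0\<close>, of x] lower[of "x - of_int \<lfloor>x / d\<rfloor> * d"]
          unfolding D_def by force
        then show ?thesis
          by blast
      qed
      then show thesis
        using that(2)[of d] \<open>d \<ge> 0\<close> int_mult \<open>d \<in> G\<close> by blast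
    qed
  qed
qed

section \<open>Local continuous lifts modulo the common periods\<close>

definition common_periods :: "(real \<Rightarrow> 'a) set \<Rightarrow> real set" where
  "common_periods F = {d. \<forall>f\<in>F. \<forall>y. f (y + d) = f y}"

lemma common_periodsD: "d \<in> common_periods F \<Longrightarrow> f \<in> F \<Longrightarrow> f (y + d) = f y"
  by (simp add: common_periods_def)

lemma zero_in_common_periods: "0 \<in> common_periods F"
  by (simp add: common_periods_def)

lemma diff_in_common_periods:
  assumes "a \<in> common_periods F" "b \<in> common_periods F"
  shows "a - b \<in> common_periods F"
proof -
  have "f (y + (a - b)) = f y" if "f \<in> F" for f y
    using common_periodsD[OF assms(1) that, of "y - b"] common_periodsD[OF assms(2) that, of "y - b"]
    by (simp add: algebra_simps)
  then show ?thesis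
    by (simp add: common_periods_def)
qed

lemma common_periods_eq_UNIV_iff:
  "common_periods F = UNIV \<longleftrightarrow> (\<forall>f\<in>F. \<exists>a. f = (\<lambda>x. a))"
proof
  assume *: "common_periods F = UNIV"
  show "\<forall>f\<in>F. \<exists>a. f = (\<lambda>x. a)"
  proof (intro ballI exI ext)
    fix f x
    assume "f \<in> F"
    then show "f x = f 0"
      using common_periodsD[of x F f 0] * by simp
  qed
next
  assume "\<forall>f\<in>F. \<exists>a. f = (\<lambda>x. a)"
  then have "\<forall>f\<in>F. \<forall>x y. f x = f y"
    by metis
  then show "common_periods F = UNIV"
    unfolding common_periods_def by blast
qed

lemma closed_common_periods:
  fixes F :: "(real \<Rightarrow> real) set"
  assumes "\<And>f. f \<in> F \<Longrightarrow> continuous_on UNIV f"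
  shows "closed (common_periods F)"
proof -
  have "common_periods F = (\<Inter>f\<in>F. \<Inter>y. {d. f (y + d) = f y})"
    by (auto simp: common_periods_def)
  moreover have "closed {d. f (y + d) = f y}" if "f \<in> F" for f y
    by (intro closed_Collect_eq continuous_intros continuous_on_compose2[OF assms[OF that]]) auto
  ultimately show ?thesis
    by (metis (no_types, lifting) closed_INT)
qed

text \<open>Collects what the topological part uses of \<open>A_set n p\<close>; derivatives enter
  only in the later sections.\<close>

locale continuous_translates =
  fixes F :: "(real \<Rightarrow> real) set" and p :: "real \<Rightarrow> real"
  assumes cont: "f \<in> F \<Longrightarrow> continuous_on UNIV f"
    and cont_translate: "f \<in> F \<Longrightarrow> continuous_on UNIV (\<lambda>x. f (p x + c))"
begin

text \<open>Along \<open>x k\<close> the values \<open>f (q (x k) + c)\<close> and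
  \<open>f (p (x k) + c)\<close> agree, and continuity gives
  \<open>f (l + c) = f (p x0 + c)\<close>. Since \<open>c\<close> is arbitrary,
  \<open>l - p x0\<close> is a period.\<close>

lemma limit_mod_periods:
  assumes x: "x \<longlonglongrightarrow> x0" and lim: "(\<lambda>k. q (x k)) \<longlonglongrightarrow> l"
    and q: "\<And>k. q (x k) - p (x k) \<in> common_periods F"
  shows "l - p x0 \<in> common_periods F"
proof -
  have "f (y + (l - p x0)) = f y" if f: "f \<in> F" for f y
  proof (rule LIMSEQ_unique)
    define c where "c = y - p x0"
    have "isCont f (l + c)" "isCont (\<lambda>x. f (p x + c)) x0"
      using cont[OF f] cont_translate[OF f] by (auto simp: continuous_on_eq_continuous_at)
    then have "(\<lambda>k. f (q (x k) + c)) \<longlonglongrightarrow> f (l + c)" "(\<lambda>k. f (p (x k) + c)) \<longlonglongrightarrow> f (p x0 + c)"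
      using lim x by (auto intro!: isCont_tendsto_compose[where g = f]
          isCont_tendsto_compose[where g = "\<lambda>x. f (p x + c)"] tendsto_intros)
    moreover have "f (q (x k) + c) = f (p (x k) + c)" for k
      using common_periodsD[OF q f, of "p (x k) + c" k] by (simp add: algebra_simps)
    ultimately show "(\<lambda>k. f (p (x k) + c)) \<longlonglongrightarrow> f (y + (l - p x0))"
      "(\<lambda>k. f (p (x k) + c)) \<longlonglongrightarrow> f y"
      by (auto simp: c_def algebra_simps)
  qed
  then show ?thesis
    by (simp add: common_periods_def)
qed

text \<open>At a discontinuity, local boundedness and compactness would yield a limit value other
  than \<open>q x0\<close>; its difference from \<open>q x0\<close> would be a nonzero period of
  modulus at most \<open>r\<close>.\<close>

lemma isCont_mod_periods:
  assumes q: "\<And>x. q x - p x \<in> common_periods F"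
    and near: "\<forall>\<^sub>F x in nhds x0. \<bar>q x - q x0\<bar> \<le> r"
    and r: "\<And>d. d \<in> common_periods F \<Longrightarrow> \<bar>d\<bar> \<le> r \<Longrightarrow> d = 0"
  shows "isCont q x0"
proof (rule ccontr)
  assume "\<not> isCont q x0"
  then obtain e where e: "e > 0" "\<And>d. d > 0 \<Longrightarrow> \<exists>x. dist x x0 < d \<and> \<not> dist (q x) (q x0) < e"
    unfolding continuous_at_eps_delta dist_real_def by blast
  obtain \<delta> where \<delta>: "\<delta> > 0" "\<And>x. dist x x0 < \<delta> \<Longrightarrow> \<bar>q x - q x0\<bar> \<le> r"
    using near unfolding eventually_nhds_metric by blast
  have "\<forall>k. \<exists>x. dist x x0 < min \<delta> (inverse (real (Suc k))) \<and> \<not> dist (q x) (q x0) < e"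
    using \<delta>(1) by (intro allI e(2)) simp
  then obtain x where x: "\<And>k. dist (x k) x0 < min \<delta> (inverse (real (Suc k)))"
      "\<And>k. e \<le> dist (q (x k)) (q x0)"
    unfolding choice_iff not_less by blast
  have "(\<lambda>k. dist (x k) x0) \<longlonglongrightarrow> 0"
    by (rule tendsto_sandwich[OF _ _ tendsto_const LIMSEQ_inverse_real_of_nat])
      (use x(1) in \<open>auto intro!: always_eventually less_imp_le\<close>)
  then have lim: "x \<longlonglongrightarrow> x0"
    by (rule tendsto_dist_iff[THEN iffD2])
  \<comment> \<open>Removing the open ball keeps the set compact and forces every limit of the
    chosen values to differ from \<open>q x0\<close>.\<close>
  define C where "C = cball (q x0) r - ball (q x0) e"
  have "compact C"
    unfolding C_def by (simp add: compact_diff)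
  moreover have "\<forall>k. q (x k) \<in> C"
    using x \<delta>(2)[of "x _"] by (simp add: C_def dist_commute[of "q x0"] not_less flip: dist_real_def)
  ultimately obtain l s where l: "l \<in> C" "strict_mono s" "((\<lambda>k. q (x k)) \<circ> s) \<longlonglongrightarrow> l"
    unfolding compact_def by metis
  have "l - p x0 \<in> common_periods F"
    using limit_mod_periods[of "x \<circ> s" x0 q l] LIMSEQ_subseq_LIMSEQ[OF lim l(2)] l(3) q
    by (simp add: o_def)
  then have "l - q x0 \<in> common_periods F"
    using diff_in_common_periods[OF _ q[of x0]] by fastforce
  then have "l = q x0"
    using r[of "l - q x0"] l(1) by (auto simp: C_def dist_real_def abs_minus_commute)
  then show False
    using l(1) \<open>e > 0\<close> by (simp add: C_def)
qed

text \<open>Values in \<open>C\<close> have a convergent subsequence, and its limit must be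
  \<open>p x0\<close> because 0 is the only period. Thus \<open>p\<close> can be discontinuous only
  by being unbounded.\<close>

lemma closed_vimage_compact:
  assumes "common_periods F = {0}" "compact C"
  shows "closed (p -` C)"
  unfolding closed_sequential_limits
proof (intro allI impI)
  fix x x0
  assume "(\<forall>k. x k \<in> p -` C) \<and> x \<longlonglongrightarrow> x0"
  then have x: "\<forall>k. p (x k) \<in> C" "x \<longlonglongrightarrow> x0"
    by auto
  then obtain l s where l: "l \<in> C" "strict_mono s" "((\<lambda>k. p (x k)) \<circ> s) \<longlonglongrightarrow> l"
    using \<open>compact C\<close> unfolding compact_def by metis
  have "l - p x0 \<in> common_periods F"
    using limit_mod_periods[of "x \<circ> s" x0 p l] LIMSEQ_subseq_LIMSEQ[OF x(2) l(2)] l(3)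
    by (simp add: o_def zero_in_common_periods)
  then show "x0 \<in> p -` C"
    using l(1) assms(1) by simp
qed

text \<open>On \<open>J\<close> the function \<open>p\<close> must tend to \<open>\<infinity>\<close> or \<open>-\<infinity>\<close> as the argument approaches \<open>e\<close>.
  By the intermediate value theorem \<open>f (t + c)\<close> then tends to \<open>f (p e + c)\<close> as \<open>t\<close> itself goes
  to \<open>\<infinity>\<close> or \<open>-\<infinity>\<close>, and this limit does not depend on \<open>c\<close>.\<close>

lemma common_periods_UNIV_if_escape:
  assumes trivial: "common_periods F = {0}"
    and J: "convex J" "e \<in> closure J" "continuous_on J p"
    and large: "\<And>x. x \<in> J \<Longrightarrow> \<bar>p x\<bar> > M" and small: "\<bar>p e\<bar> < M"
  shows "common_periods F = UNIV"
proof -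
  have nonzero: "p x \<noteq> 0" if "x \<in> J" for x
    using large[OF that] small by auto
  have "connected (p ` J)"
    using J by (intro connected_continuous_image convex_connected)
  then have "0 \<in> p ` J" if "p x \<le> 0" "0 \<le> p y" "x \<in> J" "y \<in> J" for x y
    using connected_contains_Icc[of "p ` J" "p x" "p y"] that by force
  then have "(\<forall>x\<in>J. p x > 0) \<or> (\<forall>x\<in>J. p x < 0)"
    using nonzero by (metis image_iff linorder_not_le order.strict_implies_order)
  \<comment> \<open>\<open>s\<close> is the constant sign of \<open>p\<close> on \<open>J\<close>;
    it lets the limits at \<infinity> and -\<infinity> be treated together.\<close>
  then obtain s :: real where s: "s * s = 1" "\<And>x. x \<in> J \<Longrightarrow> s * p x = \<bar>p x\<bar>"
    by (elim disjE) (metis mult_1 abs_of_pos, metis minus_mult_minus mult_1 mult_minus1 abs_of_neg)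
  have lim: "((\<lambda>t. f (s * t + c)) \<longlongrightarrow> f (p e + c)) at_top" if f: "f \<in> F" for f c
  proof (rule tendstoI)
    fix \<epsilon> :: real
    assume "\<epsilon> > 0"
    have "isCont (\<lambda>x. f (p x + c)) e"
      using cont_translate[OF f] by (simp add: continuous_on_eq_continuous_at)
    then obtain \<delta> where \<delta>: "\<delta> > 0" "\<And>x. dist x e < \<delta> \<Longrightarrow> dist (f (p x + c)) (f (p e + c)) < \<epsilon>"
      using \<open>\<epsilon> > 0\<close> unfolding continuous_at_eps_delta dist_real_def by meson
    define I where "I = (\<lambda>x. s * p x) ` (J \<inter> ball e \<delta>)"
    have "connected I"
      unfolding I_def using J
      by (intro connected_continuous_image convex_connected convex_Int continuous_intros)
        (auto intro: continuous_on_subset)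
    \<comment> \<open>The points where the modulus of \<open>p\<close> lies between \<open>M\<close>
      and \<open>t\<close> form a closed set that misses \<open>e\<close>. Near \<open>e\<close>,
      values on \<open>J\<close> already exceed \<open>M\<close> in modulus, so they must exceed
      \<open>t\<close>.\<close>
    have unbounded: "\<exists>u\<in>I. u > t" for t
    proof -
      have "closed (p -` ({-t..t} - ball 0 M))"
        using trivial by (intro closed_vimage_compact compact_diff) auto
      moreover have "e \<notin> p -` ({-t..t} - ball 0 M)"
        using small by auto
      ultimately obtain r where r: "r > 0" "\<And>x. dist x e < r \<Longrightarrow> x \<notin> p -` ({-t..t} - ball 0 M)"
        unfolding closed_def open_dist by blast
      obtain x where x: "x \<in> J" "dist x e < min r \<delta>"
        using J(2) r(1) \<delta>(1) unfolding closure_approachable by (metis min_less_iff_conj)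
      then have "s * p x > t"
        using r(2)[of x] large[of x] s(2)[of x] by auto
      then show ?thesis
        using x by (auto simp: I_def dist_commute)
    qed
    obtain u where u: "u \<in> I"
      using unbounded by blast
    show "\<forall>\<^sub>F t in at_top. dist (f (s * t + c)) (f (p e + c)) < \<epsilon>"
      using eventually_ge_at_top[of u]
    proof eventually_elim
      case (elim t)
      then have "t \<in> I"
        using unbounded[of t] connected_contains_Icc[OF \<open>connected I\<close> u] by fastforce
      then obtain x where "x \<in> ball e \<delta>" "t = s * p x"
        by (auto simp: I_def)
      then show ?case
        using \<delta>(2)[of x] s(1) by (simp add: dist_commute mult.assoc[symmetric])
    qed
  qed
  have "f (p e + c) = f (p e)" if f: "f \<in> F" for f c
  proof (rule tendsto_unique[OF _ lim[OF f]])
    \<comment> \<open>Substituting \<open>s * c + t\<close> for \<open>t\<close> in the limit for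
      shift 0 produces shift \<open>c\<close>, because \<open>s * s = 1\<close>.\<close>
    have "filterlim (\<lambda>t. s * c + t) at_top at_top"
      by (rule filterlim_tendsto_add_at_top[OF tendsto_const filterlim_ident])
    from filterlim_compose[OF lim[OF f, of 0] this]
    show "((\<lambda>t. f (s * t + c)) \<longlongrightarrow> f (p e)) at_top"
      using s(1) by (simp add: algebra_simps mult.assoc[symmetric])
  qed simp
  from this[of _ "_ - p e"] have "f y = f (p e)" if "f \<in> F" for f y
    using that by simp
  then have "f (y + d) = f y" if "f \<in> F" for f y d
    using that by metis
  then show ?thesis
    unfolding common_periods_def by blast
qed

text \<open>Baire's theorem applied to the closed set \<open>K\<close> of discontinuities yields an open interval
  meeting \<open>K\<close> such that \<open>p\<close> is bounded on the part of \<open>K\<close> in it. Values of \<open>p\<close> that are much larger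
  can then be taken only in the components of the complement of \<open>K\<close>.\<close>

lemma continuous_if_common_periods_trivial:
  assumes trivial: "common_periods F = {0}"
  shows "continuous_on UNIV p"
proof -
  define K where "K = {x. \<not> isCont p x}"
  \<comment> \<open>As 0 is the only period, any bound is an admissible radius: local boundedness
    alone implies continuity.\<close>
  have bounded_imp: "isCont p x" if "\<forall>\<^sub>F y in nhds x. \<bar>p y\<bar> \<le> r" for x r
  proof (rule isCont_mod_periods)
    show "\<forall>\<^sub>F y in nhds x. \<bar>p y - p x\<bar> \<le> r + \<bar>p x\<bar>"
      using that by eventually_elim linarith
  qed (use trivial in auto)
  have "open (- K)"
    unfolding open_contains_ball
  proof
    fix x
    assume "x \<in> - K"
    then have "isCont p x"
      by (simp add: K_def)
    then obtain \<delta> where \<delta>: "\<delta> > 0" "\<And>y. dist y x < \<delta> \<Longrightarrow> dist (p y) (p x) < 1"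
      unfolding continuous_at_eps_delta dist_real_def by (meson zero_less_one)
    have "isCont p z" if "z \<in> ball x \<delta>" for z
    proof (rule bounded_imp)
      have "\<forall>\<^sub>F y in nhds z. y \<in> ball x \<delta>"
        using that by (intro eventually_nhds_in_open) auto
      then show "\<forall>\<^sub>F y in nhds z. \<bar>p y\<bar> \<le> 1 + \<bar>p x\<bar>"
      proof eventually_elim
        case (elim y)
        then show ?case
          using \<delta>(2)[of y] by (auto simp: dist_commute dist_real_def)
      qed
    qed
    then show "\<exists>\<delta>>0. ball x \<delta> \<subseteq> - K"
      using \<delta>(1) by (auto simp: K_def)
  qed
  then have "closed K"
    by (simp add: closed_def)
  have closed_le: "closed {x. \<bar>p x\<bar> \<le> r}" for r
    using closed_vimage_compact[OF trivial, of "{-r..r}"]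
    by (simp add: vimage_def abs_le_iff minus_le_iff conj_commute)
  have "K = {}"
  proof (rule ccontr)
    assume "K \<noteq> {}"
    \<comment> \<open>These sets are relatively open in \<open>K\<close> with empty intersection, so
      by Baire's theorem some \<open>T N\<close> is not dense in \<open>K\<close>.\<close>
    define T where "T = (\<lambda>N::nat. K \<inter> - {x. \<bar>p x\<bar> \<le> real N})"
    have "\<exists>N. \<not> K \<subseteq> closure (T N)"
    proof (rule ccontr)
      assume "\<not> ?thesis"
      then have dense: "K \<subseteq> closure (T N)" for N
        by blast
      have "K \<subseteq> closure (\<Inter>(range T))"
      proof (rule Baire[OF \<open>closed K\<close>])
        show "openin (top_of_set K) S \<and> K \<subseteq> closure S" if "S \<in> range T" for S
          using that dense closed_le unfolding T_def by (auto intro!: openin_open_Int)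
      qed simp
      moreover have "\<Inter>(range T) = {}"
        using real_arch_simple by (fastforce simp: T_def)
      ultimately show False
        using \<open>K \<noteq> {}\<close> by simp
    qed
    then obtain N x0 where x0: "x0 \<in> K" "x0 \<notin> closure (T N)"
      by blast
    \<comment> \<open>The gap between \<open>N\<close> and \<open>M\<close> ensures that points of
      \<open>K\<close> near \<open>x0\<close> have values of modulus strictly below
      \<open>M\<close>. Moreover, near \<open>x0\<close> the modulus of \<open>p\<close> never
      equals \<open>M\<close>.\<close>
    define M where "M = real N + 1"
    obtain r where r: "r > 0" "\<And>x. dist x x0 < r \<Longrightarrow> x \<notin> T N"
      using x0(2) unfolding closure_approachable by auto
    have le_N: "\<bar>p x\<bar> \<le> real N" if "x \<in> K" "dist x x0 < r" for x
      using r(2)[OF that(2)] that(1) by (auto simp: T_def)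
    have "closed (p -` {-M, M})"
      by (intro closed_vimage_compact[OF trivial]) auto
    moreover have "x0 \<notin> p -` {-M, M}"
      using le_N[OF x0(1)] r(1) by (auto simp: M_def)
    ultimately obtain r' where r': "r' > 0" "\<And>x. dist x x0 < r' \<Longrightarrow> x \<notin> p -` {-M, M}"
      unfolding closed_def open_dist by blast
    have "\<bar>p x\<bar> \<le> M" if x: "dist x x0 < min r r'" for x
    proof (rule ccontr)
      assume "\<not> \<bar>p x\<bar> \<le> M"
      then have px: "\<bar>p x\<bar> > M"
        by simp
      \<comment> \<open>The point \<open>e\<close> of \<open>S\<close> nearest to \<open>x\<close>
        makes the open segment from \<open>e\<close> to \<open>x\<close> disjoint from
        \<open>K\<close>, so \<open>p\<close> is continuous there.\<close>
      define S where "S = K \<inter> closed_segment x0 x"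
      have "closed S" "S \<noteq> {}"
        using \<open>closed K\<close> x0(1) by (auto simp: S_def intro!: closed_Int)
      then obtain e where e: "e \<in> S" "\<And>y. y \<in> S \<Longrightarrow> dist x e \<le> dist x y"
        using distance_attains_inf[of S x] by blast
      have seg: "dist y x0 < min r r'" if "y \<in> closed_segment x0 x" for y
        using dist_in_closed_segment[OF that] x by (simp add: dist_commute)
      have pe: "\<bar>p e\<bar> \<le> real N"
        using e(1) seg[of e] by (intro le_N) (auto simp: S_def)
      then have "e \<noteq> x"
        using px by (auto simp: M_def)
      define J where "J = open_segment e x"
      have sub: "J \<subseteq> closed_segment x0 x"
        using e(1) unfolding J_def S_def
        by (meson Int_iff dual_order.trans ends_in_segment(2) segment_open_subset_closed subset_closed_segment)
      have notK: "y \<notin> K" if "y \<in> J" for y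
        using e(2)[of y] sub that dist_in_open_segment[of y e x]
        by (auto simp: S_def J_def dist_commute)
      have contJ: "continuous_on (insert x J) p"
      proof -
        have "x \<notin> K"
          using le_N[of x] x px by (auto simp: M_def)
        then show ?thesis
          using notK by (auto simp: K_def intro!: continuous_at_imp_continuous_on)
      qed
      have "connected (insert x J)"
      proof (rule connected_intermediate_closure[of J])
        show "insert x J \<subseteq> closure J"
          using \<open>e \<noteq> x\<close> segment_open_subset_closed[of e x]
          by (simp add: J_def closure_open_segment)
      qed (auto simp: J_def convex_connected)
      then have conn: "connected ((\<lambda>y. \<bar>p y\<bar>) ` insert x J)"
        by (intro connected_continuous_image continuous_intros contJ)
      \<comment> \<open>The endpoint \<open>x\<close> is adjoined to \<open>J\<close> because the
        modulus exceeds \<open>M\<close> there; dropping to \<open>M\<close> or below on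
        \<open>J\<close> would force the excluded value \<open>M\<close>.\<close>
      have "\<bar>p y\<bar> > M" if "y \<in> J" for y
      proof (rule ccontr)
        assume "\<not> \<bar>p y\<bar> > M"
        then have "M \<in> {\<bar>p y\<bar>..\<bar>p x\<bar>}"
          using px by simp
        also have "\<dots> \<subseteq> (\<lambda>y. \<bar>p y\<bar>) ` insert x J"
          using that by (intro connected_contains_Icc[OF conn]) auto
        finally have "M \<in> (\<lambda>y. \<bar>p y\<bar>) ` insert x J" .
        then obtain z where z: "z \<in> insert x J" "\<bar>p z\<bar> = M"
          by auto
        then have "dist z x0 < r'"
          using seg[of z] x sub by auto
        then show False
          using r'(2)[of z] z(2) by (auto simp: abs_if split: if_splits)
      qed
      moreover have "convex J" "e \<in> closure J" "continuous_on J p"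
        using \<open>e \<noteq> x\<close> contJ by (auto simp: J_def closure_open_segment intro: continuous_on_subset)
      ultimately have "common_periods F = UNIV"
        using pe by (intro common_periods_UNIV_if_escape[OF trivial, of J e M]) (auto simp: M_def)
      then show False
        using trivial by (metis UNIV_I singletonD zero_neq_one)
    qed
    then have "\<forall>\<^sub>F x in nhds x0. \<bar>p x\<bar> \<le> M"
      unfolding eventually_nhds_metric using r(1) r'(1) by (metis min_less_iff_conj)
    then show False
      using bounded_imp x0(1) by (auto simp: K_def)
  qed
  then show ?thesis
    by (auto simp: K_def intro!: continuous_at_imp_continuous_on)
qed

text \<open>For the trivial group \<open>p\<close> itself is continuous. Otherwise, reducing
  \<open>p\<close> to within half a generator of \<open>p x0\<close> makes it bounded by a radius
  that contains no nonzero period.\<close>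

lemma local_lift_mod_periods:
  assumes "common_periods F \<noteq> UNIV"
  obtains U q where "open U" "x0 \<in> U" "continuous_on U q"
    "\<forall>x\<in>U. q x - p x \<in> common_periods F"
proof -
  obtain d where d: "d \<ge> 0" "common_periods F = range (\<lambda>k. of_int k * d)"
    using closed_subgroup_real_cases[OF zero_in_common_periods diff_in_common_periods
        closed_common_periods[OF cont]] assms by metis
  show thesis
  proof (cases "d = 0")
    case True
    then have "common_periods F = {0}"
      using d(2) by auto
    then show thesis
      using continuous_if_common_periods_trivial that[of UNIV p] by (auto simp: zero_in_common_periods)
  next
    case False
    with d(1) have "d > 0"
      by simp
    have small: "g = 0" if g: "g \<in> common_periods F" "\<bar>g\<bar> \<le> d / 2" for g
    proof -
      obtain k :: int where k: "g = of_int k * d"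
        using g(1) d(2) by auto
      then have "\<bar>of_int k\<bar> * d < 1 * d"
        using g(2) \<open>d > 0\<close> by (simp add: abs_mult)
      then have "\<bar>real_of_int k\<bar> < 1"
        using \<open>d > 0\<close> by (simp only: mult_less_cancel_right_pos)
      then have "k = 0"
        by linarith
      then show ?thesis
        using k by simp
    qed
    \<comment> \<open>Rounding to the nearest integer: the summand \<open>1 / 2\<close> centres the
      range at \<open>p x0\<close>, so that \<open>q x0 = p x0\<close>.\<close>
    define q where "q x = p x - of_int \<lfloor>(p x - p x0) / d + 1 / 2\<rfloor> * d" for x
    have q: "q x - p x \<in> common_periods F" for x
      unfolding d(2) q_def by (auto intro: range_eqI[of _ _ "- \<lfloor>(p x - p x0) / d + 1 / 2\<rfloor>"])
    have q0: "q x0 = p x0"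
      by (simp add: q_def)
    have half: "\<bar>q x - q x0\<bar> \<le> d / 2" for x
    proof -
      define y where "y = (p x - p x0) / d + 1 / 2"
      have "q x - p x0 = (y - of_int \<lfloor>y\<rfloor> - 1 / 2) * d"
        using \<open>d > 0\<close> by (simp add: q_def y_def field_simps)
      moreover have "\<bar>y - of_int \<lfloor>y\<rfloor> - 1 / 2\<bar> \<le> 1 / 2"
        by linarith
      ultimately show ?thesis
        using q0 \<open>d > 0\<close> mult_right_mono[of "\<bar>y - of_int \<lfloor>y\<rfloor> - 1 / 2\<bar>" "1 / 2" d]
        by (simp add: abs_mult)
    qed
    have "\<forall>\<^sub>F x in nhds x0. \<bar>q x - q x0\<bar> \<le> d / 2"
      using half by simp
    then have "isCont q x0"
      by (rule isCont_mod_periods[OF q _ small])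
    \<comment> \<open>With \<open>d / 4\<close>, two values of \<open>q\<close> on the ball differ
      by less than \<open>d / 2\<close>, so the continuity criterion applies at every point of the
      ball and not only at \<open>x0\<close>.\<close>
    then obtain \<delta> where \<delta>: "\<delta> > 0" "\<And>x. dist x x0 < \<delta> \<Longrightarrow> dist (q x) (q x0) < d / 4"
      unfolding continuous_at_eps_delta dist_real_def using \<open>d > 0\<close> by (meson divide_pos_pos zero_less_numeral)
    have "isCont q z" if "z \<in> ball x0 \<delta>" for z
    proof (rule isCont_mod_periods[OF q _ small])
      have "\<forall>\<^sub>F x in nhds z. x \<in> ball x0 \<delta>"
        using that by (intro eventually_nhds_in_open) auto
      then show "\<forall>\<^sub>F x in nhds z. \<bar>q x - q z\<bar> \<le> d / 2"
      proof eventually_elim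
        case (elim x)
        then show ?case
          using \<delta>(2)[of x] \<delta>(2)[of z] that dist_triangle2[of "q x" "q z" "q x0"]
          by (simp add: dist_commute flip: dist_real_def)
      qed
    qed
    then have "continuous_on (ball x0 \<delta>) q"
      by (auto intro: continuous_at_imp_continuous_on)
    then show thesis
      using that[of "ball x0 \<delta>" q] q \<delta>(1) by auto
  qed
qed

end

section \<open>Functions of class \<open>C\<^sup>k\<close> on open subsets of the real line\<close>

text \<open>A local notion is needed because lifts exist only locally. The existential derivative
  lets explicit formulas serve as witnesses in inductions on the order.\<close>

fun Ck_on :: "nat \<Rightarrow> real set \<Rightarrow> (real \<Rightarrow> real) \<Rightarrow> bool" where
  "Ck_on 0 S f \<longleftrightarrow> continuous_on S f"
| "Ck_on (Suc k) S f \<longleftrightarrow> (\<exists>f'. (\<forall>x\<in>S. (f has_real_derivative f' x) (at x)) \<and> Ck_on k S f')"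

lemma Ck_on_SucE:
  assumes "Ck_on (Suc k) S f"
  obtains f' where "\<forall>x\<in>S. (f has_real_derivative f' x) (at x)" "Ck_on k S f'"
  using assms by auto

lemma Ck_on_SucI:
  "(\<And>x. x \<in> S \<Longrightarrow> (f has_real_derivative f' x) (at x)) \<Longrightarrow> Ck_on k S f' \<Longrightarrow> Ck_on (Suc k) S f"
  by auto

declare Ck_on.simps(2) [simp del]

lemma Ck_on_Suc_imp: "Ck_on (Suc k) S f \<Longrightarrow> Ck_on k S f"
proof (induction k arbitrary: f)
  case 0
  then show ?case
    by (auto intro!: continuous_at_imp_continuous_on DERIV_isCont elim!: Ck_on_SucE)
next
  case (Suc k)
  then show ?case
    by (metis Ck_on.simps(2))
qed

lemma Ck_on_imp_continuous_on: "Ck_on k S f \<Longrightarrow> continuous_on S f"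
  by (induction k) (auto intro: Ck_on_Suc_imp)

lemma Ck_on_subset: "Ck_on k S f \<Longrightarrow> T \<subseteq> S \<Longrightarrow> Ck_on k T f"
proof (induction k arbitrary: f)
  case 0
  then show ?case
    using continuous_on_subset by simp
next
  case (Suc k)
  obtain f' where "\<forall>x\<in>S. (f has_real_derivative f' x) (at x)" "Ck_on k S f'"
    using Suc.prems(1) by (rule Ck_on_SucE)
  then show ?case
    using Suc.IH Suc.prems(2) by (intro Ck_on_SucI[where f' = f']) auto
qed

lemma Ck_on_cong_imp:
  assumes "Ck_on k S f" "open S" "\<And>x. x \<in> S \<Longrightarrow> f x = g x"
  shows "Ck_on k S g"
proof (cases k)
  case 0
  then show ?thesis
    using assms continuous_on_cong[of S S f g] by simp
next
  case (Suc m)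
  from assms(1) obtain f' where f': "\<forall>x\<in>S. (f has_real_derivative f' x) (at x)" "Ck_on m S f'"
    unfolding Suc by (rule Ck_on_SucE)
  have "(g has_real_derivative f' x) (at x)" if "x \<in> S" for x
    using f'(1) that assms(2,3)
    by (intro has_field_derivative_transform_within_open[where f = f and g = g and S = S]) auto
  then show ?thesis
    unfolding Suc using f'(2) by (rule Ck_on_SucI)
qed

lemma Ck_on_deriv:
  assumes "Ck_on (Suc k) S f" "open S"
  shows "\<And>x. x \<in> S \<Longrightarrow> (f has_real_derivative deriv f x) (at x)" "Ck_on k S (deriv f)"
proof -
  obtain f' where f': "\<forall>x\<in>S. (f has_real_derivative f' x) (at x)" "Ck_on k S f'"
    using assms(1) by (rule Ck_on_SucE)
  then show "\<And>x. x \<in> S \<Longrightarrow> (f has_real_derivative deriv f x) (at x)"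
    using DERIV_imp_deriv by metis
  show "Ck_on k S (deriv f)"
    using f' DERIV_imp_deriv by (intro Ck_on_cong_imp[OF f'(2) assms(2)]) force
qed

lemma Ck_on_UNIV_iff: "Ck_on k UNIV f \<longleftrightarrow> f \<in> Cn (enat k)"
proof (induction k arbitrary: f)
  case 0
  then show ?case
    by (simp add: Cn_0 flip: zero_enat_def)
next
  case (Suc k)
  have "f differentiable_on UNIV \<longleftrightarrow> (\<forall>x. (f has_real_derivative deriv f x) (at x))"
    unfolding differentiable_on_def
    by (auto simp: DERIV_deriv_iff_real_differentiable)
  then show ?case
    using Ck_on_deriv[of k UNIV f] Ck_on_SucI[of UNIV f "deriv f" k] Suc[of "deriv f"]
    by (auto simp: Cn_Suc)
qed

text \<open>Reduces every \<open>n\<close>, including \<infinity>, to finite orders, which are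
  accessible to induction.\<close>

lemma Cn_iff: "f \<in> Cn n \<longleftrightarrow> (\<forall>k. enat k \<le> n \<longrightarrow> Ck_on k UNIV f)"
proof -
  have "f \<in> Cn n \<longleftrightarrow> (\<forall>k. enat k \<le> n \<longrightarrow> f \<in> Cn (enat k))"
  proof (intro iffI allI impI)
    fix k
    assume "f \<in> Cn n" "enat k \<le> n"
    then show "f \<in> Cn (enat k)"
      unfolding Cn_def by (auto intro: order.trans less_le_trans simp flip: enat_ord_simps)
  next
    assume *: "\<forall>k. enat k \<le> n \<longrightarrow> f \<in> Cn (enat k)"
    have "(deriv ^^ k) f differentiable_on UNIV" if "enat k < n" for k
      using *[rule_format, of "Suc k"] that unfolding Cn_def by (simp add: Suc_ile_eq)
    moreover have "continuous_on UNIV ((deriv ^^ k) f)" if "enat k \<le> n" for k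
      using *[rule_format, OF that] unfolding Cn_def by simp
    ultimately show "f \<in> Cn n"
      unfolding Cn_def by simp
  qed
  then show ?thesis
    by (simp add: Ck_on_UNIV_iff)
qed

text \<open>The local derivatives all agree with \<open>deriv f\<close>, which is therefore a global
  witness.\<close>

lemma Ck_on_UNIV_if_local:
  assumes "\<And>x. \<exists>U. open U \<and> x \<in> U \<and> Ck_on k U f"
  shows "Ck_on k UNIV f"
  using assms
proof (induction k arbitrary: f)
  case 0
  then have "isCont f x" for x
    by (metis Ck_on.simps(1) continuous_on_eq_continuous_at)
  then show ?case
    by (auto intro: continuous_at_imp_continuous_on)
next
  case (Suc k)
  show ?case
  proof (rule Ck_on_SucI)
    show "(f has_real_derivative deriv f x) (at x)" for x
      using Suc.prems[of x] Ck_on_deriv(1) by blast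
    show "Ck_on k UNIV (deriv f)"
      by (rule Suc.IH) (use Suc.prems Ck_on_deriv(2) in blast)
  qed
qed

lemma Ck_on_const: "Ck_on k S (\<lambda>x. c)"
proof (induction k arbitrary: c)
  case (Suc k)
  then show ?case
    by (intro Ck_on_SucI[where f' = "\<lambda>x. 0"]) auto
qed simp

lemma Ck_on_add: "Ck_on k S f \<Longrightarrow> Ck_on k S g \<Longrightarrow> Ck_on k S (\<lambda>x. f x + g x)"
proof (induction k arbitrary: f g)
  case (Suc k)
  then obtain f' g' where *: "\<forall>x\<in>S. (f has_real_derivative f' x) (at x)" "Ck_on k S f'"
      "\<forall>x\<in>S. (g has_real_derivative g' x) (at x)" "Ck_on k S g'"
    by (metis Ck_on_SucE)
  then show ?case
    using Suc.IH by (intro Ck_on_SucI[where f' = "\<lambda>x. f' x + g' x"] DERIV_add) auto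
qed (auto intro: continuous_intros)

lemma Ck_on_mult: "Ck_on k S f \<Longrightarrow> Ck_on k S g \<Longrightarrow> Ck_on k S (\<lambda>x. f x * g x)"
proof (induction k arbitrary: f g)
  case (Suc k)
  then obtain f' g' where *: "\<forall>x\<in>S. (f has_real_derivative f' x) (at x)" "Ck_on k S f'"
      "\<forall>x\<in>S. (g has_real_derivative g' x) (at x)" "Ck_on k S g'"
    by (metis Ck_on_SucE)
  have "Ck_on k S (\<lambda>x. f' x * g x + g' x * f x)"
    using * Suc.prems[THEN Ck_on_Suc_imp] by (simp add: Ck_on_add Suc.IH)
  with * show ?case
    by (intro Ck_on_SucI[where f' = "\<lambda>x. f' x * g x + g' x * f x"] DERIV_mult) auto
qed (auto intro: continuous_intros)

lemma Ck_on_compose: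
  assumes "Ck_on k UNIV f" "Ck_on k S g"
  shows "Ck_on k S (\<lambda>x. f (g x))"
  using assms
proof (induction k arbitrary: f g)
  case 0
  then show ?case
    using continuous_on_compose2[of UNIV f S g] by simp
next
  case (Suc k)
  obtain f' where f': "\<forall>x\<in>UNIV. (f has_real_derivative f' x) (at x)" "Ck_on k UNIV f'"
    using Suc.prems(1) by (rule Ck_on_SucE)
  obtain g' where g': "\<forall>x\<in>S. (g has_real_derivative g' x) (at x)" "Ck_on k S g'"
    using Suc.prems(2) by (rule Ck_on_SucE)
  have "Ck_on k S (\<lambda>x. f' (g x) * g' x)"
    by (rule Ck_on_mult[OF Suc.IH[OF f'(2) Ck_on_Suc_imp[OF Suc.prems(2)]] g'(2)])
  with f'(1) g'(1) show ?case
    by (intro Ck_on_SucI[where f' = "\<lambda>x. f' (g x) * g' x"] DERIV_chain2[of f]) auto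
qed

lemma Ck_on_inverse:
  assumes "Ck_on k S f" "\<And>x. x \<in> S \<Longrightarrow> f x \<noteq> 0"
  shows "Ck_on k S (\<lambda>x. inverse (f x))"
  using assms
proof (induction k arbitrary: f)
  case 0
  then show ?case
    by (auto intro: continuous_intros)
next
  case (Suc k)
  obtain f' where *: "\<forall>x\<in>S. (f has_real_derivative f' x) (at x)" "Ck_on k S f'"
    using Suc.prems(1) by (rule Ck_on_SucE)
  have inv: "Ck_on k S (\<lambda>x. inverse (f x))"
    by (rule Suc.IH[OF Ck_on_Suc_imp[OF Suc.prems(1)] Suc.prems(2)])
  have "Ck_on k S (\<lambda>x. - 1 * (inverse (f x) * f' x * inverse (f x)))"
    by (rule Ck_on_mult[OF Ck_on_const Ck_on_mult[OF Ck_on_mult[OF inv *(2)] inv]])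
  with * Suc.prems(2) show ?case
    by (intro Ck_on_SucI[where f' = "\<lambda>x. - 1 * (inverse (f x) * f' x * inverse (f x))"])
      (auto intro!: derivative_eq_intros)
qed

text \<open>No inverse of \<open>f\<close> is formed. In Caratheodory's factorization the slope
  factor is continuous and nonzero at \<open>q x\<close>; dividing the difference quotient of
  \<open>f (q z)\<close> by it leaves that of \<open>q\<close>.\<close>

lemma has_real_derivative_lift:
  fixes f q :: "real \<Rightarrow> real"
  assumes f: "(f has_real_derivative a) (at (q x))" "a \<noteq> 0"
    and h: "((\<lambda>x. f (q x)) has_real_derivative b) (at x)" and q: "isCont q x"
  shows "(q has_real_derivative b / a) (at x)"
proof -
  obtain \<phi> where \<phi>: "\<And>z. f z - f (q x) = \<phi> z * (z - q x)" "isCont \<phi> (q x)" "\<phi> (q x) = a"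
    using f(1) unfolding CARAT_DERIV by blast
  have lim: "((\<lambda>z. \<phi> (q z)) \<longlongrightarrow> a) (at x)"
    using isCont_o2[OF q \<phi>(2)] \<phi>(3) by (simp add: isCont_def)
  have "((\<lambda>z. (f (q z) - f (q x)) / (z - x) / \<phi> (q z)) \<longlongrightarrow> b / a) (at x)"
    using h f(2) lim by (intro tendsto_divide) (auto simp: has_field_derivative_iff)
  moreover have "\<forall>\<^sub>F z in at x. (f (q z) - f (q x)) / (z - x) / \<phi> (q z) = (q z - q x) / (z - x)"
    using tendsto_imp_eventually_ne[OF lim f(2)]
    by eventually_elim (simp add: \<phi>(1))
  ultimately show ?thesis
    unfolding has_field_derivative_iff by (rule Lim_transform_eventually)
qed

text \<open>Bootstrapping: the derivative of \<open>q\<close> is that of \<open>f (q x)\<close>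
  divided by \<open>deriv f (q x)\<close>, so if \<open>q\<close> has order \<open>k\<close>, so
  does its derivative.\<close>

lemma Ck_on_lift:
  assumes f: "Ck_on k UNIV f" and h: "Ck_on k S (\<lambda>x. f (q x))"
    and "open S" and q: "continuous_on S q" and nz: "\<And>x. x \<in> S \<Longrightarrow> deriv f (q x) \<noteq> 0"
  shows "Ck_on k S q"
  using f h
proof (induction k)
  case 0
  then show ?case
    using q by simp
next
  case (Suc k)
  define h where "h = (\<lambda>x. f (q x))"
  have h: "\<And>x. x \<in> S \<Longrightarrow> (h has_real_derivative deriv h x) (at x)" "Ck_on k S (deriv h)"
    using Ck_on_deriv[OF Suc.prems(2) \<open>open S\<close>] by (simp_all add: h_def)
  have "Ck_on k S q"
    by (rule Suc.IH[OF Suc.prems[THEN Ck_on_Suc_imp]])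
  then have "Ck_on k S (\<lambda>x. deriv f (q x))"
    by (rule Ck_on_compose[OF Ck_on_deriv(2)[OF Suc.prems(1) open_UNIV]])
  then have "Ck_on k S (\<lambda>x. inverse (deriv f (q x)))"
    using nz by (rule Ck_on_inverse)
  with h(2) have q': "Ck_on k S (\<lambda>x. deriv h x * inverse (deriv f (q x)))"
    by (rule Ck_on_mult)
  have "(q has_real_derivative deriv h x * inverse (deriv f (q x))) (at x)" if "x \<in> S" for x
    unfolding divide_inverse[symmetric]
  proof (rule has_real_derivative_lift)
    show "((\<lambda>x. f (q x)) has_real_derivative deriv h x) (at x)"
      using h(1)[OF that] by (simp add: h_def)
  qed (use Ck_on_deriv(1)[OF Suc.prems(1)] nz that q \<open>open S\<close> in
      \<open>auto simp: continuous_on_eq_continuous_at\<close>)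
  then show ?case
    using q' by (rule Ck_on_SucI)
qed

section \<open>The dichotomy\<close>

lemma (in continuous_translates) Ck_local_lift:
  assumes f: "f \<in> F" "\<nexists>a. f = (\<lambda>x. a)"
    and Ck: "Ck_on k UNIV f" "\<And>c. Ck_on k UNIV (\<lambda>x. f (p x + c))"
  obtains U q where "open U" "x0 \<in> U" "Ck_on k U q"
    "\<forall>x\<in>U. q x - p x \<in> common_periods F"
proof -
  have "common_periods F \<noteq> UNIV"
    using f common_periods_eq_UNIV_iff by blast
  then obtain U q where U: "open U" "x0 \<in> U" "continuous_on U q"
    and q: "\<forall>x\<in>U. q x - p x \<in> common_periods F"
    by (rule local_lift_mod_periods[of x0])
  show thesis
  proof (cases k)
    case 0
    show thesis
      by (rule that[OF U(1,2) _ q]) (simp add: 0 U(3))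
  next
    case (Suc m)
    have deriv: "(f has_real_derivative deriv f x) (at x)" for x
      by (rule Ck_on_deriv(1)[OF Ck(1)[unfolded Suc] open_UNIV UNIV_I])
    have "\<exists>t. deriv f t \<noteq> 0"
    proof (rule ccontr)
      assume "\<nexists>t. deriv f t \<noteq> 0"
      then have "\<forall>x. (f has_real_derivative 0) (at x)"
        using deriv by metis
      then have "f x = f 0" for x
        by (rule DERIV_isconst_all)
      then show False
        using f(2) by blast
    qed
    then obtain t where t: "deriv f t \<noteq> 0"
      by blast
    \<comment> \<open>The translation moves \<open>q x0\<close> to a point where the derivative of
      \<open>f\<close> is nonzero; \<open>V\<close> keeps it nonzero. This is where the freedom in
      \<open>c\<close> is used.\<close>
    define c where "c = t - q x0"
    define V where "V = U \<inter> (\<lambda>x. deriv f (q x + c)) -` (- {0})"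
    have "continuous_on UNIV (deriv f)"
      using Ck_on_deriv(2)[OF Ck(1)[unfolded Suc] open_UNIV] Ck_on_imp_continuous_on by blast
    then have "continuous_on U (\<lambda>x. deriv f (q x + c))"
      by (rule continuous_on_compose2[OF _ continuous_on_add[OF U(3) continuous_on_const]]) simp
    then have V: "open V" "x0 \<in> V" "V \<subseteq> U"
      using continuous_open_preimage[of U _ "- {0}"] U(1,2) t by (auto simp: V_def c_def)
    have "f (q x + c) = f (p x + c)" if "x \<in> V" for x
      using common_periodsD[OF _ f(1), of "q x - p x" "p x + c"] q that V(3) by (auto simp: algebra_simps)
    then have "Ck_on k V (\<lambda>x. f (q x + c))"
      using Ck_on_cong_imp[OF Ck_on_subset[OF Ck(2)[of c] subset_UNIV] V(1), of "\<lambda>x. f (q x + c)"]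
      by simp
    moreover have "continuous_on V (\<lambda>x. q x + c)"
      using continuous_on_add[OF continuous_on_subset[OF U(3) V(3)] continuous_on_const] .
    ultimately have "Ck_on k V (\<lambda>x. q x + c)"
      by (rule Ck_on_lift[OF Ck(1) _ V(1)]) (simp add: V_def)
    from Ck_on_add[OF this Ck_on_const[of k V "- c"]] have "Ck_on k V q"
      by simp
    then show thesis
      by (rule that[OF V(1,2)]) (use V(3) q in blast)
  qed
qed

theorem theorem1p1:
  fixes n :: enat and p :: "real \<Rightarrow> real"
  assumes "p \<notin> Cn n"
  shows "A_set n p = {f. \<exists>a. f = (\<lambda>x. a)} \<or>
         (\<exists>d. d \<noteq> 0 \<and> A_set n p = Cn_periodic n d)"
proof -
  define F where "F = A_set n p"
  have Cn_cont: "continuous_on UNIV f" if "f \<in> Cn n" for f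
    using that[unfolded Cn_iff, rule_format, of 0] by (simp flip: zero_enat_def)
  have F: "f \<in> F \<longleftrightarrow> f \<in> Cn n \<and> (\<forall>c. (\<lambda>x. f (p x + c)) \<in> Cn n)" for f
    by (simp add: F_def A_set_def)
  interpret continuous_translates F p
    by standard (use F Cn_cont in blast)+
  show ?thesis
  proof (cases "common_periods F = UNIV")
    case True
    have "(\<lambda>x. a) \<in> Cn n" for a
      by (simp add: Cn_iff Ck_on_const)
    then have "F = {f. \<exists>a. f = (\<lambda>x. a)}"
      using True common_periods_eq_UNIV_iff F by blast
    then show ?thesis
      by (simp add: F_def)
  next
    case False
    obtain d where d: "common_periods F = range (\<lambda>k. of_int k * d)"
      using closed_subgroup_real_cases[OF zero_in_common_periods diff_in_common_periods
          closed_common_periods[OF cont]] False by metis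
    obtain f where f: "f \<in> F" "\<nexists>a. f = (\<lambda>x. a)"
      using False common_periods_eq_UNIV_iff by blast
    \<comment> \<open>The neighbourhood and the lift may depend on \<open>k\<close>, which is
      harmless even for \<open>n = \<infinity>\<close>, since each finite order is checked
      separately.\<close>
    have lift: "\<exists>U q. open U \<and> x0 \<in> U \<and> Ck_on k U q \<and> (\<forall>x\<in>U. q x - p x \<in> common_periods F)"
      if "enat k \<le> n" for k x0
    proof -
      have "Ck_on k UNIV f" "Ck_on k UNIV (\<lambda>x. f (p x + c))" for c
        using f(1) that unfolding F Cn_iff by blast+
      from Ck_local_lift[OF f this, of x0] show ?thesis
        by metis
    qed
    \<comment> \<open>For \<open>d = 0\<close> the lifts coincide with \<open>p\<close>, which would
      give \<open>p\<close> the regularity excluded by hypothesis.\<close>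
    have "d \<noteq> 0"
    proof
      assume "d = 0"
      have "Ck_on k UNIV p" if k: "enat k \<le> n" for k
      proof (rule Ck_on_UNIV_if_local)
        fix x0
        obtain U q where U: "open U" "x0 \<in> U" "Ck_on k U q" "\<forall>x\<in>U. q x - p x \<in> common_periods F"
          using lift[OF k] by blast
        then have "Ck_on k U p"
          using d \<open>d = 0\<close> by (intro Ck_on_cong_imp[OF U(3,1)]) auto
        with U show "\<exists>U. open U \<and> x0 \<in> U \<and> Ck_on k U p"
          by blast
      qed
      then show False
        using assms by (simp add: Cn_iff)
    qed
    have "d \<in> common_periods F"
      unfolding d by (rule range_eqI[of _ _ 1]) simp
    then have "F \<subseteq> Cn_periodic n d"
      unfolding Cn_periodic_def using F common_periodsD[of d F] by blast
    \<comment> \<open>Periodicity of \<open>g\<close> allows \<open>p\<close> to be replaced locally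
      by the regular lift \<open>q\<close>, and composition preserves the class.\<close>
    moreover have "g \<in> F" if "g \<in> Cn_periodic n d" for g
    proof -
      have g: "g \<in> Cn n" "\<And>y. g (y + d) = g y"
        using that unfolding Cn_periodic_def by blast+
      interpret g: periodic_fun_simple g d
        by standard (rule g(2))
      have "Ck_on k UNIV (\<lambda>x. g (p x + c))" if k: "enat k \<le> n" for k c
      proof (rule Ck_on_UNIV_if_local)
        fix x0
        obtain U q where U: "open U" "x0 \<in> U" "Ck_on k U q" "\<forall>x\<in>U. q x - p x \<in> common_periods F"
          using lift[OF k] by blast
        have "Ck_on k UNIV g"
          using g(1) k by (simp add: Cn_iff)
        then have C: "Ck_on k U (\<lambda>x. g (q x + c))"
          by (rule Ck_on_compose[OF _ Ck_on_add[OF U(3) Ck_on_const]])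
        have "g (q x + c) = g (p x + c)" if x: "x \<in> U" for x
        proof -
          obtain j :: int where "q x - p x = of_int j * d"
            using U(4) x d by blast
          then have "q x + c = p x + c + of_int j * d"
            by simp
          then show ?thesis
            by (simp only: g.plus_of_int)
        qed
        then have "Ck_on k U (\<lambda>x. g (p x + c))"
          by (rule Ck_on_cong_imp[OF C U(1)])
        with U show "\<exists>U. open U \<and> x0 \<in> U \<and> Ck_on k U (\<lambda>x. g (p x + c))"
          by blast
      qed
      then show "g \<in> F"
        using g(1) by (simp add: F Cn_iff)
    qed
    ultimately have "F = Cn_periodic n d"
      by blast
    with \<open>d \<noteq> 0\<close> show ?thesis
      unfolding F_def by blast
  qed
qed

end
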